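(* Let $d\ge 1$ and let $k_1,\dots,k_d$ be integers such that $k_i\ge 2$ is even for every $i<d$ and $k_d\ge 3$. Let $f$ be the function on $n=2\sum_{i=1}^d k_i$ variables defined in the context. Then $\deg_{\pm}(f)=d$ and $$W(f,d)\ \ge\ 2^{(k_d-2)\prod_{i=1}^{d-1}k_i\ -\ d}.$$
   Context: Boolean functions are maps $\{0,1\}^n\to\{0,1\}$; $\mathrm{sgn}(t)=1$ if $t\ge 0$ and $\mathrm{sgn}(t)=0$ otherwise. A threshold gate for $f$ is an integer-coefficient polynomial $p$ with $f(x)=\mathrm{sgn}(p(x))$ for all $x\in\{0,1\}^n$; its weight is the sum of absolute values of its coefficients. $\deg_{\pm}(f)$ is the minimal degree of a threshold gate for $f$, and for $d\ge\deg_{\pm}(f)$, $W(f,d)$ is the minimal weight of a threshold gate for $f$ of degree at most $d$. The function $f$: the input is $(x^1,\dots,x^d,y^1,\dots,y^d)$ with $x^i=(x^i_1,\dots,x^i_{k_i}),\ y^i=(y^i_1,\dots,y^i_{k_i})\in\{0,1\}^{k_i}$. For a positive integer $k$ and $[k]=\{1,\dots,k\}$, let $<_1$ be the order $1,2,\dots,k$ and $<_0$ the reverse order $k,k-1,\dots,1$ (listed from smallest to largest); let $\mathrm{num}_1(j)=j$ and $\mathrm{num}_0(j)=k-j+1$ be the position of $j$ in these orders. Let $K=[k_1]\times\dots\times[k_d]$. To each $\alpha=(\alpha_1,\dots,\alpha_d)\in K$ associate indices $i_1(\alpha)=1$ and $i_{l+1}(\alpha)=\mathrm{num}_{i_l(\alpha)}(\alpha_l)\bmod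 2$ (computed in $[k_l]$). Order $K$ as follows: for $\alpha\ne\beta$ let $l$ be the least index with $\alpha_l\ne\beta_l$ (then $i_l(\alpha)=i_l(\beta)$); declare $\alpha<\beta$ iff $\alpha_l$ precedes $\beta_l$ in the order $<_{i_l(\alpha)}$ on $[k_l]$. Let $\alpha$ be the largest element of $K$ in this order with $\prod_{i=1}^d(x^i_{\alpha_i}-y^i_{\alpha_i})\ne 0$; then $f(x,y)=\mathrm{sgn}\prod_{i=1}^d(x^i_{\alpha_i}-y^i_{\alpha_i})$. If no such $\alpha$ exists, $f(x,y)=1$. *)

theory Defs
  imports Complex_Main "HOL-Library.Poly_Mapping" "HOL-Library.FuncSet"
begin

section \<open>Threshold gates\<close>

text \<open>
  A polynomial over \<open>\<int>\<close> in variables of type \<open>'v\<close> maps monomials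
  (finitely supported exponent functions) to coefficients, with finite support.
\<close>

type_synonym 'v int_mpoly = "('v \<Rightarrow>\<^sub>0 nat) \<Rightarrow>\<^sub>0 int"

definition mpoly_vars :: "'v int_mpoly \<Rightarrow> 'v set" where
  "mpoly_vars p = (\<Union>m\<in>Poly_Mapping.keys p. Poly_Mapping.keys m)"

definition mpoly_eval :: "'v int_mpoly \<Rightarrow> ('v \<Rightarrow> int) \<Rightarrow> int" where
  "mpoly_eval p z =
     (\<Sum>m\<in>Poly_Mapping.keys p.
        Poly_Mapping.lookup p m * (\<Prod>v\<in>Poly_Mapping.keys m. z v ^ Poly_Mapping.lookup m v))"

definition monom_degree :: "('v \<Rightarrow>\<^sub>0 nat) \<Rightarrow> nat" where
  "monom_degree m = (\<Sum>v\<in>Poly_Mapping.keys m. Poly_Mapping.lookup m v)"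

text \<open>The zero polynomial gets degree 0.\<close>

definition mpoly_degree :: "'v int_mpoly \<Rightarrow> nat" where
  "mpoly_degree p = Max (insert 0 (monom_degree ` Poly_Mapping.keys p))"

definition mpoly_weight :: "'v int_mpoly \<Rightarrow> nat" where
  "mpoly_weight p = (\<Sum>m\<in>Poly_Mapping.keys p. nat \<bar>Poly_Mapping.lookup p m\<bar>)"

text \<open>Unlike the library's \<^const>\<open>sgn\<close>, this is 1 at 0 and 0 on negative arguments.\<close>

definition sgn01 :: "int \<Rightarrow> int" where
  "sgn01 t = (if t \<ge> 0 then 1 else 0)"

definition cube :: "'v set \<Rightarrow> ('v \<Rightarrow> int) set" where
  "cube V = V \<rightarrow>\<^sub>E {0, 1}"

definition threshold_gate :: "'v set \<Rightarrow> (('v \<Rightarrow> int) \<Rightarrow> int) \<Rightarrow> 'v int_mpoly \<Rightarrow> bool" where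
  "threshold_gate V f p \<longleftrightarrow>
     mpoly_vars p \<subseteq> V \<and> (\<forall>z\<in>cube V. f z = sgn01 (mpoly_eval p z))"

definition threshold_degree :: "'v set \<Rightarrow> (('v \<Rightarrow> int) \<Rightarrow> int) \<Rightarrow> nat" where
  "threshold_degree V f = (LEAST m. \<exists>p. threshold_gate V f p \<and> mpoly_degree p = m)"

definition threshold_weight :: "'v set \<Rightarrow> (('v \<Rightarrow> int) \<Rightarrow> int) \<Rightarrow> nat \<Rightarrow> nat" where
  "threshold_weight V f d =
     (LEAST w. \<exists>p. threshold_gate V f p \<and> mpoly_degree p \<le> d \<and> mpoly_weight p = w)"


section \<open>The Boolean function\<close>

text \<open>\<open>X i j\<close> and \<open>Y i j\<close> are the variables \<open>x\<^sup>i\<^sub>j\<close> and \<open>y\<^sup>i\<^sub>j\<close>; indices start at 1.\<close>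

datatype xy_var = X nat nat | Y nat nat

definition xy_vars :: "nat \<Rightarrow> (nat \<Rightarrow> nat) \<Rightarrow> xy_var set" where
  "xy_vars d k = (\<Union>i\<in>{1..d}. X i ` {1..k i} \<union> Y i ` {1..k i})"

text \<open>In the next two definitions \<open>b\<close> is the subscript, 0 or 1, of the order on \<open>{1..n}\<close>.\<close>

definition num :: "nat \<Rightarrow> nat \<Rightarrow> nat \<Rightarrow> nat" where
  "num n b j = (if b = 1 then j else n - j + 1)"

definition precedes :: "nat \<Rightarrow> nat \<Rightarrow> nat \<Rightarrow> bool" where
  "precedes b j j' \<longleftrightarrow> (if b = 1 then j < j' else j' < j)"

definition K :: "nat \<Rightarrow> (nat \<Rightarrow> nat) \<Rightarrow> (nat \<Rightarrow> nat) set" where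
  "K d k = (\<Pi>\<^sub>E i\<in>{1..d}. {1..k i})"

text \<open>\<open>ind k \<alpha> l\<close> is \<open>i\<^sub>l(\<alpha>)\<close> for \<open>l \<ge> 1\<close>; the value at 0 is never used.\<close>

fun ind :: "(nat \<Rightarrow> nat) \<Rightarrow> (nat \<Rightarrow> nat) \<Rightarrow> nat \<Rightarrow> nat" where
  "ind k \<alpha> 0 = 1"
| "ind k \<alpha> (Suc 0) = 1"
| "ind k \<alpha> (Suc (Suc l)) = num (k (Suc l)) (ind k \<alpha> (Suc l)) (\<alpha> (Suc l)) mod 2"

definition K_less :: "nat \<Rightarrow> (nat \<Rightarrow> nat) \<Rightarrow> (nat \<Rightarrow> nat) \<Rightarrow> (nat \<Rightarrow> nat) \<Rightarrow> bool" where
  "K_less d k \<alpha> \<beta> \<longleftrightarrow>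
     (\<exists>l\<in>{1..d}. (\<forall>m\<in>{1..<l}. \<alpha> m = \<beta> m) \<and> \<alpha> l \<noteq> \<beta> l \<and>
                precedes (ind k \<alpha> l) (\<alpha> l) (\<beta> l))"

definition diff_prod :: "nat \<Rightarrow> (xy_var \<Rightarrow> int) \<Rightarrow> (nat \<Rightarrow> nat) \<Rightarrow> int" where
  "diff_prod d z \<alpha> = (\<Prod>i=1..d. z (X i (\<alpha> i)) - z (Y i (\<alpha> i)))"

definition nonvanishing :: "nat \<Rightarrow> (nat \<Rightarrow> nat) \<Rightarrow> (xy_var \<Rightarrow> int) \<Rightarrow> (nat \<Rightarrow> nat) set" where
  "nonvanishing d k z = {\<alpha> \<in> K d k. diff_prod d z \<alpha> \<noteq> 0}"

definition is_largest :: "nat \<Rightarrow> (nat \<Rightarrow> nat) \<Rightarrow> (nat \<Rightarrow> nat) set \<Rightarrow> (nat \<Rightarrow> nat) \<Rightarrow> bool" where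
  "is_largest d k S \<alpha> \<longleftrightarrow> \<alpha> \<in> S \<and> (\<forall>\<beta>\<in>S. \<beta> \<noteq> \<alpha> \<longrightarrow> K_less d k \<beta> \<alpha>)"

definition xy_fun :: "nat \<Rightarrow> (nat \<Rightarrow> nat) \<Rightarrow> (xy_var \<Rightarrow> int) \<Rightarrow> int" where
  "xy_fun d k z =
     (if nonvanishing d k z = {} then 1
      else sgn01 (diff_prod d z (THE \<alpha>. is_largest d k (nonvanishing d k z) \<alpha>)))"


section \<open>Well-definedness\<close>

lemma card_xy_vars: "card (xy_vars d k) = 2 * (\<Sum>i=1..d. k i)"
proof -
  have "card (X i ` {1..k i} \<union> Y i ` {1..k i}) = 2 * k i" for i
    by (subst card_Un_disjoint) (auto simp: card_image inj_on_def)
  then show ?thesis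
    unfolding xy_vars_def
    by (subst card_UN_disjoint) (auto simp: sum_distrib_left)
qed

lemma finite_K: "finite (K d k)"
  by (auto simp: K_def intro: finite_PiE)

lemma ind_cong:
  assumes "\<forall>m\<in>{1..<l}. \<alpha> m = \<beta> m"
  shows "ind k \<alpha> l = ind k \<beta> l"
  using assms by (induction k \<alpha> l rule: ind.induct) auto

lemma K_less_irrefl: "\<not> K_less d k \<alpha> \<alpha>"
  by (simp add: K_less_def)

lemma K_less_trans:
  assumes "K_less d k \<alpha> \<beta>" "K_less d k \<beta> \<gamma>"
  shows "K_less d k \<alpha> \<gamma>"
proof -
  obtain l where l: "l \<in> {1..d}" "\<forall>m\<in>{1..<l}. \<alpha> m = \<beta> m" "\<alpha> l \<noteq> \<beta> l"
      "precedes (ind k \<alpha> l) (\<alpha> l) (\<beta> l)"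
    using assms(1) by (auto simp: K_less_def)
  obtain l' where l': "l' \<in> {1..d}" "\<forall>m\<in>{1..<l'}. \<beta> m = \<gamma> m" "\<beta> l' \<noteq> \<gamma> l'"
      "precedes (ind k \<beta> l') (\<beta> l') (\<gamma> l')"
    using assms(2) by (auto simp: K_less_def)
  have i: "ind k \<alpha> l = ind k \<beta> l" by (rule ind_cong) (rule l(2))
  consider "l < l'" | "l = l'" | "l' < l" by linarith
  then show ?thesis
  proof cases
    case 1
    then have "\<beta> l = \<gamma> l" using l(1) l'(2) by auto
    then show ?thesis
      unfolding K_less_def using 1 l l'(2) by (intro bexI[of _ l]) auto
  next
    case 2
    have p: "precedes (ind k \<alpha> l) (\<alpha> l) (\<gamma> l)"
      using l(4) l'(4) i 2 by (auto simp: precedes_def split: if_splits)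
    then have "\<alpha> l \<noteq> \<gamma> l" by (auto simp: precedes_def split: if_splits)
    then show ?thesis
      unfolding K_less_def using 2 l(1,2) l'(2) p by (intro bexI[of _ l]) auto
  next
    case 3
    then have "\<alpha> l' = \<beta> l'" using l'(1) l(2) by auto
    moreover have "ind k \<alpha> l' = ind k \<beta> l'"
      by (rule ind_cong) (use 3 l(2) in auto)
    ultimately show ?thesis
      unfolding K_less_def using 3 l(2) l' by (intro bexI[of _ l']) auto
  qed
qed

lemma K_less_total:
  assumes "\<alpha> \<in> K d k" "\<beta> \<in> K d k" "\<alpha> \<noteq> \<beta>"
  shows "K_less d k \<alpha> \<beta> \<or> K_less d k \<beta> \<alpha>"
proof -
  define P where "P l \<longleftrightarrow> l \<in> {1..d} \<and> \<alpha> l \<noteq> \<beta> l" for l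
  have "\<exists>l. P l"
  proof (rule ccontr)
    assume "\<nexists>l. P l"
    then have "\<alpha> = \<beta>"
      using assms(1,2) unfolding K_def P_def by (intro PiE_ext) auto
    then show False using assms(3) by simp
  qed
  then have l: "P (Least P)" by (rule LeastI_ex)
  have eq: "\<forall>m\<in>{1..<Least P}. \<alpha> m = \<beta> m"
  proof
    fix m assume m: "m \<in> {1..<Least P}"
    then have "\<not> P m" using not_less_Least[of m P] by simp
    then show "\<alpha> m = \<beta> m" using m l by (simp add: P_def[of m] P_def[of "Least P"])
  qed
  have i: "ind k \<alpha> (Least P) = ind k \<beta> (Least P)" by (rule ind_cong) (rule eq)
  have "precedes (ind k \<alpha> (Least P)) (\<alpha> (Least P)) (\<beta> (Least P)) \<or>
        precedes (ind k \<beta> (Least P)) (\<beta> (Least P)) (\<alpha> (Least P))"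
    using l unfolding i P_def precedes_def by auto
  moreover have "Least P \<in> {1..d}" "\<alpha> (Least P) \<noteq> \<beta> (Least P)"
    using l by (simp_all add: P_def)
  moreover have "\<forall>m\<in>{1..<Least P}. \<beta> m = \<alpha> m" using eq by simp
  ultimately show ?thesis
    unfolding K_less_def using eq by (elim disjE) (blast, metis)
qed

lemma ex1_is_largest:
  assumes "S \<subseteq> K d k" "S \<noteq> {}"
  shows "\<exists>!\<alpha>. is_largest d k S \<alpha>"
proof -
  have "finite S" using assms(1) finite_K by (rule finite_subset)
  then have "\<exists>\<alpha>. is_largest d k S \<alpha>" using assms(2,1)
  proof (induction S rule: finite_ne_induct)
    case (singleton \<alpha>)
    then show ?case by (auto simp: is_largest_def)
  next
    case (insert \<beta> S)
    then obtain \<alpha> where a: "is_largest d k S \<alpha>" by auto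
    then have "K_less d k \<alpha> \<beta> \<or> K_less d k \<beta> \<alpha>"
      using insert.hyps insert.prems by (intro K_less_total) (auto simp: is_largest_def)
    then show ?case
    proof
      assume "K_less d k \<alpha> \<beta>"
      then have "is_largest d k (insert \<beta> S) \<beta>"
        using a unfolding is_largest_def by (metis K_less_trans insert_iff)
      then show ?thesis by blast
    next
      assume "K_less d k \<beta> \<alpha>"
      then have "is_largest d k (insert \<beta> S) \<alpha>"
        using a unfolding is_largest_def by auto
      then show ?thesis by blast
    qed
  qed
  moreover have "\<alpha> = \<beta>" if "is_largest d k S \<alpha>" "is_largest d k S \<beta>" for \<alpha> \<beta>
    using that unfolding is_largest_def by (metis K_less_irrefl K_less_trans)
  ultimately show ?thesis by blast
qed

end

theory Submission
  imports Defs
begin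

text \<open>
  Antisymmetrizing a gate \<open>p\<close> of degree at most \<open>d\<close> under the \<open>d\<close> swaps \<open>x\<^sup>i \<leftrightarrow> y\<^sup>i\<close> kills every
  monomial that misses some block, which leaves a multilinear form \<open>\<Sum>\<^sub>\<alpha> c\<^sub>\<alpha> \<Prod>\<^sub>i (x\<^sup>i - y\<^sup>i)\<^bsub>\<alpha>\<^sub>i\<^esub>\<close> (and
  nothing at all if the degree is below \<open>d\<close>). This form still has the sign of \<open>f\<close>, so \<open>c\<^sub>\<beta>\<close> exceeds the
  sum of any \<open>c\<^sub>\<alpha>\<close> with \<open>\<alpha> < \<beta>\<close> that differ from \<open>\<beta>\<close> in one common coordinate. Along a run in the last
  coordinate the coefficients therefore grow by a factor \<open>2^(k d - 2)\<close>. Consecutive runs are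
  traversed in opposite directions, so the end of one run and the beginning of the next differ in a
  single coordinate and no growth is lost. The largest coefficient is a value of the antisymmetrized
  form, which is a signed sum of \<open>2^d\<close> values of \<open>p\<close> on the cube, hence at most \<open>2^d\<close> times the weight.
\<close>

section \<open>Polynomials on the cube\<close>

lemma mpoly_eval_superset:
  assumes "finite S" "Poly_Mapping.keys p \<subseteq> S"
  shows "mpoly_eval p z =
    (\<Sum>m\<in>S. Poly_Mapping.lookup p m * (\<Prod>v\<in>Poly_Mapping.keys m. z v ^ Poly_Mapping.lookup m v))"
  unfolding mpoly_eval_def using assms
  by (intro sum.mono_neutral_left) (auto simp: in_keys_iff)

lemma mpoly_eval_add: "mpoly_eval (p + q) z = mpoly_eval p z + mpoly_eval q z"
proof -
  let ?S = "Poly_Mapping.keys p \<union> Poly_Mapping.keys q"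
  have "Poly_Mapping.keys (p + q) \<subseteq> ?S" by (rule Poly_Mapping.keys_add)
  then show ?thesis
    by (simp add: mpoly_eval_superset[of ?S] lookup_add distrib_right sum.distrib)
qed

lemma mpoly_eval_single:
  "mpoly_eval (Poly_Mapping.single m c) z =
    c * (\<Prod>v\<in>Poly_Mapping.keys m. z v ^ Poly_Mapping.lookup m v)"
  by (simp add: mpoly_eval_superset[of "{m}"])

lemma mpoly_degree_le_iff:
  "mpoly_degree p \<le> D \<longleftrightarrow> (\<forall>m\<in>Poly_Mapping.keys p. monom_degree m \<le> D)"
  unfolding mpoly_degree_def by (subst Max_le_iff) auto

lemma ex_multilinear_monom:
  assumes "finite M"
  shows "\<exists>m :: 'v \<Rightarrow>\<^sub>0 nat. Poly_Mapping.keys m = M \<and> monom_degree m = card M \<and>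
    (\<forall>z :: 'v \<Rightarrow> int. (\<Prod>v\<in>Poly_Mapping.keys m. z v ^ Poly_Mapping.lookup m v) = (\<Prod>v\<in>M. z v))"
proof -
  define m where "m = Abs_poly_mapping (\<lambda>v. if v \<in> M then 1 else 0 :: nat)"
  have lk: "Poly_Mapping.lookup m v = (if v \<in> M then 1 else 0)" for v
    unfolding m_def using assms by (subst lookup_Abs_poly_mapping) auto
  then have "Poly_Mapping.keys m = M" by (auto simp: in_keys_iff split: if_splits)
  then show ?thesis
    by (intro exI[of _ m]) (auto simp: monom_degree_def lk)
qed

text \<open>This turns an explicit sum of products into an actual polynomial. Terms with the same
  variable set may merge or cancel, so the degree is only bounded from above.\<close>

lemma ex_mpoly_of_terms:
  fixes c :: "'i \<Rightarrow> int" and M :: "'i \<Rightarrow> 'v set"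
  assumes "finite I" "\<And>i. i \<in> I \<Longrightarrow> finite (M i) \<and> M i \<subseteq> V \<and> card (M i) \<le> D"
  shows "\<exists>p. mpoly_vars p \<subseteq> V \<and> mpoly_degree p \<le> D \<and>
    (\<forall>z. mpoly_eval p z = (\<Sum>i\<in>I. c i * (\<Prod>v\<in>M i. z v)))"
  using assms
proof (induction I rule: finite_induct)
  case empty
  show ?case
    by (intro exI[of _ 0]) (simp add: mpoly_vars_def mpoly_degree_le_iff mpoly_eval_def)
next
  case (insert i I)
  then obtain p where p: "mpoly_vars p \<subseteq> V" "mpoly_degree p \<le> D"
      "\<And>z. mpoly_eval p z = (\<Sum>i\<in>I. c i * (\<Prod>v\<in>M i. z v))"
    by auto
  obtain m :: "'v \<Rightarrow>\<^sub>0 nat" where m: "Poly_Mapping.keys m = M i" "monom_degree m = card (M i)"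
      "\<And>z :: 'v \<Rightarrow> int. (\<Prod>v\<in>Poly_Mapping.keys m. z v ^ Poly_Mapping.lookup m v) = (\<Prod>v\<in>M i. z v)"
    using ex_multilinear_monom[of "M i"] insert.prems by auto
  let ?q = "Poly_Mapping.single m (c i) + p"
  have keys: "Poly_Mapping.keys ?q \<subseteq> insert m (Poly_Mapping.keys p)"
    using Poly_Mapping.keys_add[of "Poly_Mapping.single m (c i)" p] by (auto split: if_splits)
  have "mpoly_vars ?q \<subseteq> M i \<union> mpoly_vars p"
    unfolding mpoly_vars_def using UN_mono[OF keys subset_refl, of Poly_Mapping.keys] m(1) by simp
  then have "mpoly_vars ?q \<subseteq> V" using p(1) insert.prems[of i] by blast
  moreover have "mpoly_degree ?q \<le> D"
    using keys p(2) m(2) insert.prems[of i] unfolding mpoly_degree_le_iff by auto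
  moreover have "mpoly_eval ?q z = (\<Sum>i\<in>insert i I. c i * (\<Prod>v\<in>M i. z v))" for z
    using insert.hyps by (simp add: mpoly_eval_add mpoly_eval_single m(3) p(3))
  ultimately show ?case by blast
qed

lemma cube_01: "z \<in> cube V \<Longrightarrow> v \<in> V \<Longrightarrow> z v = 0 \<or> z v = 1"
  unfolding cube_def by (auto dest: PiE_mem)

text \<open>A positive power of 0 or 1 is the number itself, so on the cube a monomial depends only
  on its set of variables.\<close>

lemma mpoly_eval_cube:
  assumes "z \<in> cube V" "mpoly_vars p \<subseteq> V"
  shows "mpoly_eval p z =
    (\<Sum>m\<in>Poly_Mapping.keys p. Poly_Mapping.lookup p m * (\<Prod>v\<in>Poly_Mapping.keys m. z v))"
  unfolding mpoly_eval_def
proof (intro sum.cong refl arg_cong2[where f = "(*)"] prod.cong)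
  fix m v assume "m \<in> Poly_Mapping.keys p" and v: "v \<in> Poly_Mapping.keys m"
  then have "v \<in> V" using assms(2) by (auto simp: mpoly_vars_def)
  then have "z v = 0 \<or> z v = 1" using assms(1) by (intro cube_01)
  moreover have "Poly_Mapping.lookup m v > 0" using v by (simp add: in_keys_iff)
  ultimately show "z v ^ Poly_Mapping.lookup m v = z v" by auto
qed

lemma abs_prod_le_1:
  fixes f :: "'a \<Rightarrow> int"
  assumes "\<And>i. i \<in> A \<Longrightarrow> \<bar>f i\<bar> \<le> 1"
  shows "\<bar>prod f A\<bar> \<le> 1"
  using assms
  by (induction A rule: infinite_finite_induct) (auto simp: abs_mult intro: mult_le_one)

lemma abs_mpoly_eval_le_weight:
  assumes "z \<in> cube V" "mpoly_vars p \<subseteq> V"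
  shows "\<bar>mpoly_eval p z\<bar> \<le> int (mpoly_weight p)"
proof -
  have "\<bar>mpoly_eval p z\<bar> \<le>
      (\<Sum>m\<in>Poly_Mapping.keys p. \<bar>Poly_Mapping.lookup p m * (\<Prod>v\<in>Poly_Mapping.keys m. z v)\<bar>)"
    unfolding mpoly_eval_cube[OF assms] by (rule sum_abs)
  also have "\<dots> \<le> (\<Sum>m\<in>Poly_Mapping.keys p. \<bar>Poly_Mapping.lookup p m\<bar>)"
  proof (rule sum_mono)
    fix m assume m: "m \<in> Poly_Mapping.keys p"
    have "\<bar>\<Prod>v\<in>Poly_Mapping.keys m. z v\<bar> \<le> 1"
    proof (rule abs_prod_le_1)
      fix v assume "v \<in> Poly_Mapping.keys m"
      then have "v \<in> V" using m assms(2) by (auto simp: mpoly_vars_def)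
      then show "\<bar>z v\<bar> \<le> 1" using cube_01[OF assms(1)] by force
    qed
    then show "\<bar>Poly_Mapping.lookup p m * (\<Prod>v\<in>Poly_Mapping.keys m. z v)\<bar>
        \<le> \<bar>Poly_Mapping.lookup p m\<bar>"
      by (simp add: abs_mult mult_left_le)
  qed
  also have "\<dots> = int (mpoly_weight p)" by (simp add: mpoly_weight_def)
  finally show ?thesis .
qed

lemma card_keys_le_monom_degree: "card (Poly_Mapping.keys m) \<le> monom_degree m"
proof -
  have "card (Poly_Mapping.keys m) = (\<Sum>v\<in>Poly_Mapping.keys m. 1)" by simp
  also have "\<dots> \<le> monom_degree m"
    unfolding monom_degree_def by (intro sum_mono) (simp add: in_keys_iff Suc_le_eq)
  finally show ?thesis .
qed


section \<open>Antisymmetrization\<close>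

fun block :: "xy_var \<Rightarrow> nat" where
  "block (X i j) = i"
| "block (Y i j) = i"

fun flip :: "xy_var \<Rightarrow> xy_var" where
  "flip (X i j) = Y i j"
| "flip (Y i j) = X i j"

definition swap_blocks :: "nat set \<Rightarrow> xy_var \<Rightarrow> xy_var" where
  "swap_blocks T v = (if block v \<in> T then flip v else v)"

text \<open>Not divided by \<open>2 ^ d\<close>, so that all values stay integers.\<close>

definition antisymmetrize :: "nat \<Rightarrow> ((xy_var \<Rightarrow> int) \<Rightarrow> int) \<Rightarrow> (xy_var \<Rightarrow> int) \<Rightarrow> int" where
  "antisymmetrize d F z = (\<Sum>T\<in>Pow {1..d}. (-1) ^ card T * F (z \<circ> swap_blocks T))"

lemma swap_blocks_in_xy_vars_iff: "swap_blocks T v \<in> xy_vars d k \<longleftrightarrow> v \<in> xy_vars d k"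
  by (cases v) (auto simp: swap_blocks_def xy_vars_def)

lemma cube_swap_blocks:
  assumes "z \<in> cube (xy_vars d k)"
  shows "z \<circ> swap_blocks T \<in> cube (xy_vars d k)"
  unfolding cube_def
proof (rule PiE_I)
  show "(z \<circ> swap_blocks T) v \<in> {0, 1}" if "v \<in> xy_vars d k" for v
    using cube_01[OF assms, of "swap_blocks T v"] that by (simp add: swap_blocks_in_xy_vars_iff)
  show "(z \<circ> swap_blocks T) v = undefined" if "v \<notin> xy_vars d k" for v
    using assms that PiE_arb[of z "xy_vars d k" _ "swap_blocks T v"]
    by (simp add: cube_def swap_blocks_in_xy_vars_iff)
qed

lemma prod_if_uminus:
  assumes "finite A" "T \<subseteq> A"
  shows "(\<Prod>i\<in>A. if i \<in> T then - g i else g i :: int) = (-1) ^ card T * (\<Prod>i\<in>A. g i)"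
proof -
  have "(\<Prod>i\<in>A. if i \<in> T then - g i else g i) = (\<Prod>i\<in>A. (if i \<in> T then -1 else 1) * g i)"
    by (intro prod.cong) auto
  also have "\<dots> = (\<Prod>i\<in>A. if i \<in> T then -1 else 1) * (\<Prod>i\<in>A. g i)"
    by (rule prod.distrib)
  also have "(\<Prod>i\<in>A. if i \<in> T then -1 else 1 :: int) = (-1) ^ card T"
    using assms by (simp add: prod.If_cases Int_absorb1)
  finally show ?thesis .
qed

text \<open>Expanding the product means choosing \<open>- h i\<close> for i in T and
  \<open>g i\<close> elsewhere. It serves to factor an antisymmetrized monomial, and later to expand
  \<open>diff_prod\<close> into monomials.\<close>

lemma sum_Pow_prod_diff:
  fixes g h :: "'a \<Rightarrow> int"
  assumes "finite A"
  shows "(\<Sum>T\<in>Pow A. (-1) ^ card T * (\<Prod>i\<in>A. if i \<in> T then h i else g i)) = (\<Prod>i\<in>A. g i - h i)"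
proof -
  have "(\<Prod>i\<in>A. g i - h i) = (\<Prod>i\<in>A. - h i + g i)" by simp
  also have "\<dots> = (\<Sum>T\<in>Pow A. (\<Prod>i\<in>T. - h i) * (\<Prod>i\<in>A - T. g i))"
    using assms by (rule prod_add)
  also have "\<dots> = (\<Sum>T\<in>Pow A. (-1) ^ card T * (\<Prod>i\<in>A. if i \<in> T then h i else g i))"
  proof (intro sum.cong refl)
    fix T assume "T \<in> Pow A"
    then have T: "A \<inter> {i. i \<in> T} = T" "A \<inter> - {i. i \<in> T} = A - T" by auto
    show "(\<Prod>i\<in>T. - h i) * (\<Prod>i\<in>A - T. g i) =
        (-1) ^ card T * (\<Prod>i\<in>A. if i \<in> T then h i else g i)"
      unfolding prod.If_cases[OF assms] T by (simp add: prod_uminus)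
  qed
  finally show ?thesis by simp
qed

lemma diff_prod_swap_blocks:
  assumes "T \<subseteq> {1..d}"
  shows "diff_prod d (z \<circ> swap_blocks T) \<alpha> = (-1) ^ card T * diff_prod d z \<alpha>"
proof -
  have "diff_prod d (z \<circ> swap_blocks T) \<alpha> =
      (\<Prod>i=1..d. if i \<in> T then - (z (X i (\<alpha> i)) - z (Y i (\<alpha> i)))
                         else z (X i (\<alpha> i)) - z (Y i (\<alpha> i)))"
    unfolding diff_prod_def by (intro prod.cong) (auto simp: swap_blocks_def)
  then show ?thesis
    using prod_if_uminus[of "{1..d}" T] assms by (simp add: diff_prod_def)
qed

text \<open>A swap of block i touches only the variables of block i, so the signed sum over all T
  factors over the blocks.\<close>

lemma antisymmetrize_prod:
  assumes "finite M" "M \<subseteq> xy_vars d k"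
  shows "antisymmetrize d (\<lambda>z. \<Prod>v\<in>M. z v) z =
    (\<Prod>i=1..d. (\<Prod>v\<in>{v \<in> M. block v = i}. z v) - (\<Prod>v\<in>{v \<in> M. block v = i}. z (flip v)))"
proof -
  have "(\<Prod>v\<in>M. z (swap_blocks T v)) =
      (\<Prod>i=1..d. if i \<in> T then \<Prod>v\<in>{v \<in> M. block v = i}. z (flip v)
                         else \<Prod>v\<in>{v \<in> M. block v = i}. z v)" for T
  proof -
    have "block ` M \<subseteq> {1..d}" using assms(2) by (auto simp: xy_vars_def)
    then have "(\<Prod>v\<in>M. z (swap_blocks T v)) =
        (\<Prod>i=1..d. \<Prod>v\<in>{v \<in> M. block v = i}. z (swap_blocks T v))"
      using assms(1) by (intro prod.group[symmetric]) auto
    also have "\<dots> = (\<Prod>i=1..d. if i \<in> T then \<Prod>v\<in>{v \<in> M. block v = i}. z (flip v)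
                         else \<Prod>v\<in>{v \<in> M. block v = i}. z v)"
      by (intro prod.cong refl) (auto simp: swap_blocks_def intro!: prod.cong)
    finally show ?thesis .
  qed
  then show ?thesis
    unfolding antisymmetrize_def by (simp add: sum_Pow_prod_diff)
qed

lemma card_eq_sum_block:
  assumes "finite M" "M \<subseteq> xy_vars d k"
  shows "card M = (\<Sum>i=1..d. card {v \<in> M. block v = i})"
proof -
  have "block ` M \<subseteq> {1..d}" using assms(2) by (auto simp: xy_vars_def)
  then have "(\<Sum>i=1..d. \<Sum>v\<in>{v \<in> M. block v = i}. 1) = (\<Sum>v\<in>M. 1::nat)"
    using assms(1) by (intro sum.group) auto
  then show ?thesis by simp
qed

text \<open>The missing block contributes the factor 1 - 1.\<close>

lemma antisymmetrize_prod_eq_0: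
  assumes "finite M" "M \<subseteq> xy_vars d k" "i \<in> {1..d}" "{v \<in> M. block v = i} = {}"
  shows "antisymmetrize d (\<lambda>z. \<Prod>v\<in>M. z v) z = 0"
proof -
  have "(\<Prod>v\<in>{v \<in> M. block v = i}. z v) - (\<Prod>v\<in>{v \<in> M. block v = i}. z (flip v)) = 0"
    unfolding assms(4) by simp
  then show ?thesis
    unfolding antisymmetrize_prod[OF assms(1,2)] using assms(3) by (intro prod_zero) auto
qed

lemma antisymmetrize_prod_low_degree:
  assumes "finite M" "M \<subseteq> xy_vars d k" "card M < d"
  shows "antisymmetrize d (\<lambda>z. \<Prod>v\<in>M. z v) z = 0"
proof -
  have "\<exists>i\<in>{1..d}. {v \<in> M. block v = i} = {}"
  proof (rule ccontr)
    assume "\<not> ?thesis"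
    then have "(\<Sum>i=1..d. 1) \<le> (\<Sum>i=1..d. card {v \<in> M. block v = i})"
      using assms(1) by (intro sum_mono) (simp add: Suc_le_eq card_gt_0_iff)
    then show False using assms(3) card_eq_sum_block[OF assms(1,2)] by simp
  qed
  then show ?thesis using antisymmetrize_prod_eq_0[OF assms(1,2)] by blast
qed

text \<open>With at most d variables, either some block is missed and everything vanishes, or each
  block is met exactly once. In the second case each factor is an x - y difference up to sign, so a
  single index carries a nonzero coefficient.\<close>

lemma antisymmetrize_prod_multilinear:
  assumes "finite M" "M \<subseteq> xy_vars d k" "card M \<le> d"
  shows "\<exists>c. \<forall>z. antisymmetrize d (\<lambda>z. \<Prod>v\<in>M. z v) z = (\<Sum>\<alpha>\<in>K d k. c \<alpha> * diff_prod d z \<alpha>)"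
proof (cases "\<exists>i\<in>{1..d}. {v \<in> M. block v = i} = {}")
  case True
  then have "antisymmetrize d (\<lambda>z. \<Prod>v\<in>M. z v) z = 0" for z
    using antisymmetrize_prod_eq_0[OF assms(1,2)] by blast
  then show ?thesis by (intro exI[of _ "\<lambda>_. 0"]) simp
next
  case False
  have ge: "1 \<le> card {v \<in> M. block v = i}" if "i \<in> {1..d}" for i
    using False that assms(1) by (simp add: Suc_le_eq card_gt_0_iff)
  have "card {v \<in> M. block v = i} = 1" if "i \<in> {1..d}" for i
  proof (rule ccontr)
    assume "card {v \<in> M. block v = i} \<noteq> 1"
    then have "1 < card {v \<in> M. block v = i}" using ge[OF that] by linarith
    then have "(\<Sum>i=1..d. 1) < (\<Sum>i=1..d. card {v \<in> M. block v = i})"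
      using ge that by (intro sum_strict_mono_ex1) auto
    then show False using assms(3) card_eq_sum_block[OF assms(1,2)] by simp
  qed
  then have "\<forall>i\<in>{1..d}. \<exists>v. {v \<in> M. block v = i} = {v}" by (simp add: card_1_singleton_iff)
  then obtain w where w: "\<And>i. i \<in> {1..d} \<Longrightarrow> {v \<in> M. block v = i} = {w i}" by metis
  have "\<exists>j s. j \<in> {1..k i} \<and> (\<forall>z. z (w i) - z (flip (w i)) = s * (z (X i j) - z (Y i j) :: int))"
    if "i \<in> {1..d}" for i
  proof -
    have wi: "w i \<in> M" "block (w i) = i" using w[OF that] by auto
    then have V: "w i \<in> xy_vars d k" using assms(2) by blast
    show ?thesis
    proof (cases "w i")
      case (X i' j)
      then show ?thesis using wi V by (intro exI[of _ j] exI[of _ 1]) (auto simp: xy_vars_def)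
    next
      case (Y i' j)
      then show ?thesis using wi V by (intro exI[of _ j] exI[of _ "-1"]) (auto simp: xy_vars_def)
    qed
  qed
  then obtain a s where as: "\<And>i. i \<in> {1..d} \<Longrightarrow> a i \<in> {1..k i}"
      "\<And>i z. i \<in> {1..d} \<Longrightarrow> z (w i) - z (flip (w i)) = s i * (z (X i (a i)) - z (Y i (a i)) :: int)"
    by metis
  \<comment> \<open>The restriction is there because elements of \<open>K\<close> are
    extensional.\<close>
  define \<alpha> where "\<alpha> = restrict a {1..d}"
  have \<alpha>: "\<alpha> \<in> K d k" using as(1) by (auto simp: \<alpha>_def K_def)
  have eq: "antisymmetrize d (\<lambda>z. \<Prod>v\<in>M. z v) z = (\<Prod>i=1..d. s i) * diff_prod d z \<alpha>" for z
    unfolding antisymmetrize_prod[OF assms(1,2)] diff_prod_def prod.distrib[symmetric]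
    by (intro prod.cong refl) (simp add: w as(2) \<alpha>_def)
  show ?thesis
  proof (intro exI allI)
    fix z
    have "(\<Sum>\<beta>\<in>K d k. (if \<beta> = \<alpha> then \<Prod>i=1..d. s i else 0) * diff_prod d z \<beta>) =
        (\<Sum>\<beta>\<in>K d k. if \<beta> = \<alpha> then (\<Prod>i=1..d. s i) * diff_prod d z \<beta> else 0)"
      by (intro sum.cong) auto
    also have "\<dots> = (\<Prod>i=1..d. s i) * diff_prod d z \<alpha>" using \<alpha> finite_K by simp
    finally show "antisymmetrize d (\<lambda>z. \<Prod>v\<in>M. z v) z =
        (\<Sum>\<beta>\<in>K d k. (if \<beta> = \<alpha> then \<Prod>i=1..d. s i else 0) * diff_prod d z \<beta>)"
      using eq by simp
  qed
qed

lemma antisymmetrize_mpoly_eval: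
  assumes "z \<in> cube (xy_vars d k)" "mpoly_vars p \<subseteq> xy_vars d k"
  shows "antisymmetrize d (mpoly_eval p) z = (\<Sum>m\<in>Poly_Mapping.keys p.
    Poly_Mapping.lookup p m * antisymmetrize d (\<lambda>z. \<Prod>v\<in>Poly_Mapping.keys m. z v) z)"
proof -
  have "antisymmetrize d (mpoly_eval p) z = (\<Sum>T\<in>Pow {1..d}. \<Sum>m\<in>Poly_Mapping.keys p.
      Poly_Mapping.lookup p m * ((-1) ^ card T * (\<Prod>v\<in>Poly_Mapping.keys m. (z \<circ> swap_blocks T) v)))"
    unfolding antisymmetrize_def
    by (simp add: mpoly_eval_cube[OF cube_swap_blocks[OF assms(1)] assms(2)] sum_distrib_left
        mult.left_commute)
  also have "\<dots> = (\<Sum>m\<in>Poly_Mapping.keys p.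
      Poly_Mapping.lookup p m * antisymmetrize d (\<lambda>z. \<Prod>v\<in>Poly_Mapping.keys m. z v) z)"
    unfolding antisymmetrize_def sum_distrib_left by (rule sum.swap)
  finally show ?thesis .
qed

lemma antisymmetrize_gate_multilinear:
  assumes "mpoly_vars p \<subseteq> xy_vars d k" "mpoly_degree p \<le> d"
  shows "\<exists>c. \<forall>z\<in>cube (xy_vars d k).
    antisymmetrize d (mpoly_eval p) z = (\<Sum>\<alpha>\<in>K d k. c \<alpha> * diff_prod d z \<alpha>)"
proof -
  have "\<forall>m\<in>Poly_Mapping.keys p. \<exists>c. \<forall>z. antisymmetrize d (\<lambda>z. \<Prod>v\<in>Poly_Mapping.keys m. z v) z =
      (\<Sum>\<alpha>\<in>K d k. c \<alpha> * diff_prod d z \<alpha>)"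
  proof
    fix m assume m: "m \<in> Poly_Mapping.keys p"
    have "card (Poly_Mapping.keys m) \<le> d"
      using card_keys_le_monom_degree[of m] assms(2) m by (auto simp: mpoly_degree_le_iff)
    moreover have "Poly_Mapping.keys m \<subseteq> xy_vars d k"
      using assms(1) m by (auto simp: mpoly_vars_def)
    ultimately show "\<exists>c. \<forall>z. antisymmetrize d (\<lambda>z. \<Prod>v\<in>Poly_Mapping.keys m. z v) z =
      (\<Sum>\<alpha>\<in>K d k. c \<alpha> * diff_prod d z \<alpha>)"
      by (intro antisymmetrize_prod_multilinear) simp
  qed
  then obtain C where C: "\<And>m z. m \<in> Poly_Mapping.keys p \<Longrightarrow>
      antisymmetrize d (\<lambda>z. \<Prod>v\<in>Poly_Mapping.keys m. z v) z = (\<Sum>\<alpha>\<in>K d k. C m \<alpha> * diff_prod d z \<alpha>)"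
    by metis
  show ?thesis
  proof (intro exI ballI)
    fix z assume z: "z \<in> cube (xy_vars d k)"
    have "antisymmetrize d (mpoly_eval p) z = (\<Sum>m\<in>Poly_Mapping.keys p. \<Sum>\<alpha>\<in>K d k.
        Poly_Mapping.lookup p m * C m \<alpha> * diff_prod d z \<alpha>)"
      unfolding antisymmetrize_mpoly_eval[OF z assms(1)] by (simp add: C sum_distrib_left mult.assoc)
    also have "\<dots> = (\<Sum>\<alpha>\<in>K d k. (\<Sum>m\<in>Poly_Mapping.keys p. Poly_Mapping.lookup p m * C m \<alpha>) *
        diff_prod d z \<alpha>)"
      unfolding sum_distrib_right by (rule sum.swap)
    finally show "antisymmetrize d (mpoly_eval p) z =
        (\<Sum>\<alpha>\<in>K d k. (\<Sum>m\<in>Poly_Mapping.keys p. Poly_Mapping.lookup p m * C m \<alpha>) * diff_prod d z \<alpha>)" .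
  qed
qed

lemma antisymmetrize_gate_low_degree:
  assumes "mpoly_vars p \<subseteq> xy_vars d k" "mpoly_degree p < d" "z \<in> cube (xy_vars d k)"
  shows "antisymmetrize d (mpoly_eval p) z = 0"
  unfolding antisymmetrize_mpoly_eval[OF assms(3,1)]
proof (intro sum.neutral ballI)
  fix m assume m: "m \<in> Poly_Mapping.keys p"
  have "monom_degree m \<le> mpoly_degree p" using m mpoly_degree_le_iff[of p "mpoly_degree p"] by auto
  then have "card (Poly_Mapping.keys m) < d"
    using card_keys_le_monom_degree[of m] assms(2) by simp
  moreover have "Poly_Mapping.keys m \<subseteq> xy_vars d k"
    using assms(1) m by (auto simp: mpoly_vars_def)
  ultimately show "Poly_Mapping.lookup p m * antisymmetrize d (\<lambda>z. \<Prod>v\<in>Poly_Mapping.keys m. z v) z = 0"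
    by (simp add: antisymmetrize_prod_low_degree)
qed

text \<open>There are \<open>2 ^ d\<close> summands, each a value of p on the cube up to sign. This
  is the source of the loss of d in the final exponent.\<close>

lemma abs_antisymmetrize_gate_le:
  assumes "mpoly_vars p \<subseteq> xy_vars d k" "z \<in> cube (xy_vars d k)"
  shows "\<bar>antisymmetrize d (mpoly_eval p) z\<bar> \<le> 2 ^ d * int (mpoly_weight p)"
proof -
  have "\<bar>antisymmetrize d (mpoly_eval p) z\<bar> \<le>
      (\<Sum>T\<in>Pow {1..d}. \<bar>(-1) ^ card T * mpoly_eval p (z \<circ> swap_blocks T)\<bar>)"
    unfolding antisymmetrize_def by (rule sum_abs)
  also have "\<dots> \<le> (\<Sum>T\<in>Pow {1..d}. int (mpoly_weight p))"
    using abs_mpoly_eval_le_weight[OF cube_swap_blocks[OF assms(2)] assms(1)]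
    by (intro sum_mono) (simp add: abs_mult power_abs)
  also have "\<dots> = 2 ^ d * int (mpoly_weight p)" by (simp add: card_Pow)
  finally show ?thesis .
qed

section \<open>The sign of an antisymmetrized gate\<close>

lemma xy_fun_eq:
  assumes "is_largest d k (nonvanishing d k z) \<alpha>"
  shows "xy_fun d k z = sgn01 (diff_prod d z \<alpha>)"
proof -
  have ne: "nonvanishing d k z \<noteq> {}" using assms by (auto simp: is_largest_def)
  have "(THE \<alpha>. is_largest d k (nonvanishing d k z) \<alpha>) = \<alpha>"
    using ex1_is_largest[OF _ ne] assms by (intro the1_equality) (auto simp: nonvanishing_def)
  then show ?thesis using ne by (simp add: xy_fun_def)
qed

text \<open>Swaps keep the leading index and multiply its product by the sign of T, so f forces
  every signed summand to be nonnegative.\<close>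

lemma antisymmetrize_gate_pos:
  assumes "d \<ge> 1" "threshold_gate (xy_vars d k) (xy_fun d k) p" "z \<in> cube (xy_vars d k)"
    and "is_largest d k (nonvanishing d k z) \<alpha>" "diff_prod d z \<alpha> > 0"
  shows "antisymmetrize d (mpoly_eval p) z > 0"
proof -
  have eval: "sgn01 (mpoly_eval p (z \<circ> swap_blocks T)) = sgn01 ((-1) ^ card T * diff_prod d z \<alpha>)"
    if T: "T \<subseteq> {1..d}" for T
  proof -
    have "nonvanishing d k (z \<circ> swap_blocks T) = nonvanishing d k z"
      by (simp add: nonvanishing_def diff_prod_swap_blocks[OF T])
    then have "xy_fun d k (z \<circ> swap_blocks T) = sgn01 ((-1) ^ card T * diff_prod d z \<alpha>)"
      using xy_fun_eq[of d k "z \<circ> swap_blocks T" \<alpha>] assms(4) by (simp add: diff_prod_swap_blocks[OF T])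
    then show ?thesis
      using assms(2) cube_swap_blocks[OF assms(3)] by (auto simp: threshold_gate_def)
  qed
  have "0 \<le> (-1) ^ card T * mpoly_eval p (z \<circ> swap_blocks T)" if T: "T \<subseteq> {1..d}" for T
    using eval[OF T] assms(5) by (cases "even (card T)") (auto simp: sgn01_def split: if_splits)
  \<comment> \<open>Strictness needs a T of odd size: \<open>sgn01\<close> is 1 at 0, so a summand
    with even T may vanish, while value 0 of \<open>sgn01\<close> forces p to be strictly
    negative.\<close>
  moreover have "{1} \<subseteq> {1..d}" using assms(1) by simp
  moreover have "0 < (-1) ^ card {1::nat} * mpoly_eval p (z \<circ> swap_blocks {1})"
    using eval[of "{1}"] assms(1,5) by (auto simp: sgn01_def split: if_splits)
  ultimately show ?thesis
    unfolding antisymmetrize_def by (intro sum_pos2[of _ "{1}"]) auto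
qed

section \<open>Growth of the coefficients\<close>

text \<open>Evaluating on \<open>u\<^sup>l = e(\<beta>\<^sub>l) - (\<Sum>j\<in>S. e(j))\<close> and \<open>u\<^sup>i = e(\<beta>\<^sub>i)\<close> for \<open>i \<noteq> l\<close>,
  where \<open>u\<^sup>i = x\<^sup>i - y\<^sup>i\<close>, makes \<open>\<beta>\<close> the leading index.\<close>

definition test_point :: "nat \<Rightarrow> (nat \<Rightarrow> nat) \<Rightarrow> (nat \<Rightarrow> nat) \<Rightarrow> nat \<Rightarrow> nat set \<Rightarrow> xy_var \<Rightarrow> int" where
  "test_point d k \<beta> l S = restrict
     (\<lambda>v. case v of X i j \<Rightarrow> of_bool (j = \<beta> i) | Y i j \<Rightarrow> of_bool (i = l \<and> j \<in> S)) (xy_vars d k)"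

lemma test_point_in_cube: "test_point d k \<beta> l S \<in> cube (xy_vars d k)"
  unfolding cube_def test_point_def by (auto simp: of_bool_def split: xy_var.split)

lemma K_upd: "\<beta> \<in> K d k \<Longrightarrow> l \<in> {1..d} \<Longrightarrow> j \<in> {1..k l} \<Longrightarrow> \<beta>(l := j) \<in> K d k"
  unfolding K_def by (auto simp: PiE_iff extensional_def)

lemma diff_prod_test_point:
  assumes "\<beta> \<in> K d k" "\<alpha> \<in> K d k" "l \<in> {1..d}" "S \<subseteq> {1..k l}" "\<beta> l \<notin> S"
  shows "diff_prod d (test_point d k \<beta> l S) \<alpha> =
    (if \<alpha> = \<beta> then 1 else if \<alpha> \<in> (\<lambda>j. \<beta>(l := j)) ` S then -1 else 0)"
proof -
  \<comment> \<open>Off coordinate l the factor just tests agreement with \<beta>; at l it is 1 at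
    \<open>\<beta> l\<close>, -1 on S and 0 elsewhere.\<close>
  define t where "t i = (of_bool (\<alpha> i = \<beta> i) - of_bool (i = l \<and> \<alpha> i \<in> S) :: int)" for i
  have "diff_prod d (test_point d k \<beta> l S) \<alpha> = (\<Prod>i=1..d. t i)"
    unfolding diff_prod_def
  proof (intro prod.cong refl)
    fix i assume i: "i \<in> {1..d}"
    then have "\<alpha> i \<in> {1..k i}" using assms(2) by (auto simp: K_def)
    then have "X i (\<alpha> i) \<in> xy_vars d k" "Y i (\<alpha> i) \<in> xy_vars d k"
      using i unfolding xy_vars_def by blast+
    then show "test_point d k \<beta> l S (X i (\<alpha> i)) - test_point d k \<beta> l S (Y i (\<alpha> i)) = t i"
      by (simp add: test_point_def t_def)
  qed
  also have "\<dots> = t l * (\<Prod>i\<in>{1..d} - {l}. t i)" using assms(3) by (intro prod.remove) auto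
  also have "(\<Prod>i\<in>{1..d} - {l}. t i) = of_bool (\<forall>i\<in>{1..d} - {l}. \<alpha> i = \<beta> i)"
  proof (cases "\<forall>i\<in>{1..d} - {l}. \<alpha> i = \<beta> i")
    case True
    then have "(\<Prod>i\<in>{1..d} - {l}. t i) = 1" by (intro prod.neutral) (auto simp: t_def)
    then show ?thesis using True by simp
  next
    case False
    then obtain i where "i \<in> {1..d} - {l}" "\<alpha> i \<noteq> \<beta> i" by blast
    then have "i \<in> {1..d} - {l}" "t i = 0" by (auto simp: t_def)
    then have "(\<Prod>i\<in>{1..d} - {l}. t i) = 0" by (intro prod_zero) auto
    then show ?thesis unfolding of_bool_def using False by presburger
  qed
  also have "t l * of_bool (\<forall>i\<in>{1..d} - {l}. \<alpha> i = \<beta> i) =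
    (if \<alpha> = \<beta> then 1 else if \<alpha> \<in> (\<lambda>j. \<beta>(l := j)) ` S then -1 else 0)"
  proof (cases "\<forall>i\<in>{1..d} - {l}. \<alpha> i = \<beta> i")
    case True
    \<comment> \<open>Outside \<open>{1..d}\<close> both functions are \<open>undefined\<close>, so
      agreement off l on \<open>{1..d}\<close> suffices.\<close>
    have eq: "\<alpha> = \<beta>(l := \<alpha> l)"
    proof
      fix i show "\<alpha> i = (\<beta>(l := \<alpha> l)) i"
      proof (cases "i \<in> {1..d}")
        case False
        then have "\<alpha> i = undefined" "\<beta> i = undefined"
          using assms(1,2) unfolding K_def by (auto dest: PiE_arb)
        then show ?thesis using False assms(3) by auto
      qed (use True in auto)
    qed
    have "\<alpha> = \<beta> \<longleftrightarrow> \<alpha> l = \<beta> l" using eq by (metis fun_upd_triv)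
    moreover have "\<alpha> \<in> (\<lambda>j. \<beta>(l := j)) ` S \<longleftrightarrow> \<alpha> l \<in> S" using eq by (metis (no_types, lifting) fun_upd_same imageE imageI)
    ultimately show ?thesis using True assms(5) by (auto simp: t_def)
  next
    case False
    then have "\<alpha> \<noteq> \<beta>" "\<alpha> \<notin> (\<lambda>j. \<beta>(l := j)) ` S" by auto
    then show ?thesis using False by simp
  qed
  finally show ?thesis .
qed

text \<open>The direction at l depends only on coordinates below l. Directions above l may change,
  but the comparison is already decided at l.\<close>

lemma K_less_upd:
  assumes "l \<in> {1..d}" "precedes (ind k \<beta> l) j (\<beta> l)"
  shows "K_less d k (\<beta>(l := j)) \<beta>"
proof -
  have "ind k (\<beta>(l := j)) l = ind k \<beta> l" by (rule ind_cong) auto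
  then show ?thesis
    unfolding K_less_def using assms
    by (intro bexI[of _ l]) (auto simp: precedes_def split: if_splits)
qed

lemma precedes_irrefl: "\<not> precedes b j j"
  by (simp add: precedes_def)

lemma is_largest_test_point:
  assumes "\<beta> \<in> K d k" "l \<in> {1..d}" "S \<subseteq> {1..k l}"
    and prec: "\<And>j. j \<in> S \<Longrightarrow> precedes (ind k \<beta> l) j (\<beta> l)"
  shows "is_largest d k (nonvanishing d k (test_point d k \<beta> l S)) \<beta>"
proof -
  have nS: "\<beta> l \<notin> S" using prec precedes_irrefl by blast
  have eq: "nonvanishing d k (test_point d k \<beta> l S) \<subseteq> insert \<beta> ((\<lambda>j. \<beta>(l := j)) ` S)"
    using diff_prod_test_point[OF assms(1) _ assms(2,3) nS]
    unfolding nonvanishing_def by (auto split: if_splits)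
  have "\<beta> \<in> nonvanishing d k (test_point d k \<beta> l S)"
    using diff_prod_test_point[OF assms(1) assms(1) assms(2,3) nS] assms(1)
    by (simp add: nonvanishing_def)
  then show ?thesis
    unfolding is_largest_def using eq K_less_upd[OF assms(2) prec] by blast
qed

lemma sum_test_point:
  assumes "\<beta> \<in> K d k" "l \<in> {1..d}" "S \<subseteq> {1..k l}" "\<beta> l \<notin> S"
  shows "(\<Sum>\<alpha>\<in>K d k. c \<alpha> * diff_prod d (test_point d k \<beta> l S) \<alpha>) =
    c \<beta> - (\<Sum>j\<in>S. c (\<beta>(l := j)))"
proof -
  let ?I = "(\<lambda>j. \<beta>(l := j)) ` S"
  have I: "?I \<subseteq> K d k" using K_upd[OF assms(1,2)] assms(3) by auto
  have nI: "\<beta> \<notin> ?I" using assms(4) by (metis (no_types, lifting) fun_upd_same imageE)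
  have fin: "finite ?I" using I finite_K by (rule finite_subset)
  have inj: "inj_on (\<lambda>j. \<beta>(l := j)) S" by (rule inj_onI) (metis fun_upd_same)
  have "(\<Sum>\<alpha>\<in>K d k. c \<alpha> * diff_prod d (test_point d k \<beta> l S) \<alpha>) =
      (\<Sum>\<alpha>\<in>insert \<beta> ?I. c \<alpha> * diff_prod d (test_point d k \<beta> l S) \<alpha>)"
    using I assms(1) finite_K diff_prod_test_point[OF assms(1) _ assms(2-4)]
    by (intro sum.mono_neutral_right) auto
  also have "\<dots> = c \<beta> + (\<Sum>\<alpha>\<in>?I. - c \<alpha>)"
  proof -
    have "diff_prod d (test_point d k \<beta> l S) \<alpha> = -1" if "\<alpha> \<in> ?I" for \<alpha>
    proof -
      have "\<alpha> \<in> K d k" "\<alpha> \<noteq> \<beta>" using that I nI by blast+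
      then show ?thesis using diff_prod_test_point[OF assms(1) _ assms(2-4), of \<alpha>] that by simp
    qed
    then have "(\<Sum>\<alpha>\<in>?I. c \<alpha> * diff_prod d (test_point d k \<beta> l S) \<alpha>) = (\<Sum>\<alpha>\<in>?I. - c \<alpha>)"
      by (intro sum.cong) simp_all
    then show ?thesis
      unfolding sum.insert[OF fin nI] using diff_prod_test_point[OF assms(1,1) assms(2-4)] by simp
  qed
  also have "\<dots> = c \<beta> - (\<Sum>j\<in>S. c (\<beta>(l := j)))"
    by (simp add: sum_negf sum.reindex[OF inj])
  finally show ?thesis .
qed

text \<open>All that the growth argument needs from the gate. Empty S gives positivity, singletons
  give monotonicity across a change of one coordinate, and initial segments give doubling.\<close>

definition dominating :: "nat \<Rightarrow> (nat \<Rightarrow> nat) \<Rightarrow> ((nat \<Rightarrow> nat) \<Rightarrow> int) \<Rightarrow> bool" where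
  "dominating d k c \<longleftrightarrow> (\<forall>\<beta>\<in>K d k. \<forall>l\<in>{1..d}. \<forall>S\<subseteq>{1..k l}.
     (\<forall>j\<in>S. precedes (ind k \<beta> l) j (\<beta> l)) \<longrightarrow> (\<Sum>j\<in>S. c (\<beta>(l := j))) < c \<beta>)"

text \<open>At the test point the leading product is 1, so the form is positive there, and its value
  is the difference of the two sides of the inequality.\<close>

lemma dominating_gate_coefficients:
  assumes "d \<ge> 1" "threshold_gate (xy_vars d k) (xy_fun d k) p"
    and c: "\<forall>z\<in>cube (xy_vars d k).
      antisymmetrize d (mpoly_eval p) z = (\<Sum>\<alpha>\<in>K d k. c \<alpha> * diff_prod d z \<alpha>)"
  shows "dominating d k c"
  unfolding dominating_def
proof (intro ballI allI impI)
  fix \<beta> l S assume \<beta>: "\<beta> \<in> K d k" and l: "l \<in> {1..d}" and S: "S \<subseteq> {1..k l}"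
    and prec: "\<forall>j\<in>S. precedes (ind k \<beta> l) j (\<beta> l)"
  let ?z = "test_point d k \<beta> l S"
  have nS: "\<beta> l \<notin> S" using prec precedes_irrefl by blast
  have "antisymmetrize d (mpoly_eval p) ?z > 0"
    using is_largest_test_point[OF \<beta> l S] prec diff_prod_test_point[OF \<beta> \<beta> l S nS]
    by (intro antisymmetrize_gate_pos[OF assms(1,2) test_point_in_cube]) auto
  then show "(\<Sum>j\<in>S. c (\<beta>(l := j))) < c \<beta>"
    using c test_point_in_cube sum_test_point[OF \<beta> l S nS] by simp
qed

text \<open>A test point with empty S isolates the single coefficient at \<beta>; the choice of
  coordinate 1 is arbitrary.\<close>

lemma gate_coefficient_le:
  assumes "d \<ge> 1" "mpoly_vars p \<subseteq> xy_vars d k" "\<beta> \<in> K d k"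
    and c: "\<forall>z\<in>cube (xy_vars d k).
      antisymmetrize d (mpoly_eval p) z = (\<Sum>\<alpha>\<in>K d k. c \<alpha> * diff_prod d z \<alpha>)"
  shows "c \<beta> \<le> 2 ^ d * int (mpoly_weight p)"
proof -
  have "antisymmetrize d (mpoly_eval p) (test_point d k \<beta> 1 {}) = c \<beta>"
    using c test_point_in_cube sum_test_point[OF assms(3), of 1 "{}" c] assms(1) by simp
  then show ?thesis
    using abs_antisymmetrize_gate_le[OF assms(2) test_point_in_cube[of d k \<beta> 1 "{}"]] by simp
qed

lemma dominating_pos: "dominating d k c \<Longrightarrow> d \<ge> 1 \<Longrightarrow> \<beta> \<in> K d k \<Longrightarrow> c \<beta> > 0"
  unfolding dominating_def by (drule bspec, assumption, drule bspec[of _ _ 1], simp,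
      drule spec[of _ "{}"]) simp

section \<open>Exponential growth along the Gray code\<close>

lemma superincreasing_growth:
  fixes v :: "nat \<Rightarrow> int"
  assumes "n \<ge> 1" "v 1 \<ge> 0" "\<And>p. p \<in> {2..n} \<Longrightarrow> (\<Sum>q=1..<p. v q) \<le> v p"
  shows "2 ^ (n - 1) * v 1 \<le> (\<Sum>q=1..n. v q)"
  using assms
proof (induction n rule: dec_induct)
  case base
  then show ?case by simp
next
  case (step n)
  \<comment> \<open>Each new term is at least the prefix sum before it, so the prefix sum at least
    doubles.\<close>
  have "(\<Sum>q=1..<Suc n. v q) \<le> v (Suc n)" using step.hyps step.prems(2)[of "Suc n"] by simp
  then have "(\<Sum>q=1..n. v q) \<le> v (Suc n)" by (simp add: atLeastLessThanSuc_atLeastAtMost)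
  moreover have "2 ^ (n - 1) * v 1 \<le> (\<Sum>q=1..n. v q)"
    using step.prems by (intro step.IH) auto
  moreover have "(2::int) ^ n = 2 * 2 ^ (n - 1)" using step.hyps by (cases n) auto
  ultimately show ?case using step.hyps by simp
qed

text \<open>Inverse of \<open>num\<close> on \<open>{1..n}\<close>: the element at position p of the
  order with subscript b, counted from 1.\<close>

definition element_at :: "nat \<Rightarrow> nat \<Rightarrow> nat \<Rightarrow> nat" where
  "element_at n b p = (if b = 1 then p else n + 1 - p)"

text \<open>The tail of ones is the one shared by both ends of a traversal; \<open>undefined\<close>
  beyond d keeps the function extensional.\<close>

definition fill :: "nat \<Rightarrow> nat \<Rightarrow> (nat \<Rightarrow> nat) \<Rightarrow> nat \<Rightarrow> nat \<Rightarrow> nat" where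
  "fill d l \<alpha> a = (\<lambda>i. if i < l then \<alpha> i else if i = l then a else if i \<le> d then 1 else undefined)"

lemma fill_in_K:
  assumes "\<alpha> \<in> K d k" "l \<in> {1..d}" "a \<in> {1..k l}" "\<forall>i\<in>{1..d}. k i \<ge> 1"
  shows "fill d l \<alpha> a \<in> K d k"
  using assms unfolding K_def fill_def by (auto simp: PiE_iff extensional_def)

lemma fill_upd: "(fill d l \<alpha> a)(l := b) = fill d l \<alpha> b"
  by (auto simp: fill_def)

lemma fill_fill: "l < d \<Longrightarrow> fill d (Suc l) (fill d l \<alpha> a) 1 = fill d l \<alpha> a"
  by (auto simp: fill_def)

lemma ind_fill: "ind k (fill d l \<alpha> a) l = ind k \<alpha> l"
  by (rule ind_cong) (auto simp: fill_def)

lemma k_pos: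
  fixes k :: "nat \<Rightarrow> nat"
  assumes "\<forall>i\<in>{1..<d}. k i \<ge> 2 \<and> even (k i)" "k d \<ge> 3"
  shows "\<forall>i\<in>{1..d}. k i \<ge> 1"
proof
  fix i assume "i \<in> {1..d}"
  then show "k i \<ge> 1" using assms by (cases "i = d") force+
qed

text \<open>The order on \<open>K\<close> is a Gray code: because \<open>k i\<close> is even for \<open>i < d\<close>, the last element of each
  sub-block and the first element of the next one agree except in the coordinate \<open>l\<close>, and the first
  and last elements of a block with fixed coordinates below \<open>l\<close> are 1 above \<open>l\<close>.\<close>

lemma block_growth:
  assumes dom: "dominating d k c" and "1 \<le> l" "l \<le> d"
    and ev: "\<forall>i\<in>{1..<d}. k i \<ge> 2 \<and> even (k i)" and kd: "k d \<ge> 3"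
    and "\<alpha> \<in> K d k"
  shows "2 ^ ((k d - 2) * (\<Prod>i=l..<d. k i)) * c (fill d l \<alpha> (element_at (k l) (ind k \<alpha> l) 1))
    \<le> c (fill d l \<alpha> (element_at (k l) (ind k \<alpha> l) (k l)))"
  using \<open>l \<le> d\<close> \<open>1 \<le> l\<close> \<open>\<alpha> \<in> K d k\<close>
\<comment> \<open>Induction downwards from l = d. The index \<alpha> is generalized because the step
  applies the hypothesis to every \<open>A p\<close>.\<close>
proof (induction l arbitrary: \<alpha> rule: inc_induct)
  case base
  have k1: "\<forall>i\<in>{1..d}. k i \<ge> 1" using ev kd by (rule k_pos)
  let ?a = "element_at (k d) (ind k \<alpha> d)"
  \<comment> \<open>The coefficients along one run in the last coordinate, in the order of
    traversal.\<close>
  define v where "v p = c (fill d d \<alpha> (?a p))" for p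
  have a: "?a p \<in> {1..k d}" if "p \<in> {1..k d}" for p using that by (auto simp: element_at_def)
  have K: "fill d d \<alpha> (?a p) \<in> K d k" if "p \<in> {1..k d}" for p
    using base k1 a[OF that] by (intro fill_in_K) auto
  have v: "(\<Sum>q=1..<p. v q) < v p" if p: "p \<in> {1..k d}" for p
  proof -
    let ?S = "?a ` {1..<p}"
    have inj: "inj_on ?a {1..<p}" using p by (auto simp: inj_on_def element_at_def)
    have "(\<Sum>j\<in>?S. c ((fill d d \<alpha> (?a p))(d := j))) < c (fill d d \<alpha> (?a p))"
    proof (rule dom[unfolded dominating_def, rule_format, OF K[OF p]])
      show "d \<in> {1..d}" using base by simp
      show "?S \<subseteq> {1..k d}" using p by (auto simp: element_at_def)
      show "precedes (ind k (fill d d \<alpha> (?a p)) d) j (fill d d \<alpha> (?a p) d)" if "j \<in> ?S" for j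
        unfolding ind_fill using that p by (auto simp: precedes_def element_at_def fill_def)
    qed
    then show ?thesis unfolding sum.reindex[OF inj] by (simp add: fill_upd v_def)
  qed
  \<comment> \<open>The first \<open>k d - 1\<close> positions give \<open>k d - 2\<close> doublings
    of the prefix sum, and the last coefficient exceeds that whole sum.\<close>
  have "2 ^ (k d - 1 - 1) * v 1 \<le> (\<Sum>q=1..k d - 1. v q)"
    using v kd v[of 1] by (intro superincreasing_growth) (auto intro!: less_imp_le)
  also have "\<dots> = (\<Sum>q=1..<k d. v q)" using kd by (intro sum.cong) auto
  also have "\<dots> \<le> v (k d)" using v[of "k d"] kd by simp
  finally show ?case by (simp add: v_def numeral_2_eq_2)
next
  case (step l)
  have k1: "\<forall>i\<in>{1..d}. k i \<ge> 1" using ev kd by (rule k_pos)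
  define E where "E = (k d - 2) * (\<Prod>i=Suc l..<d. k i)"
  let ?b = "ind k \<alpha> l"
  define A where "A p = fill d l \<alpha> (element_at (k l) ?b p)" for p
  have kl: "k l \<ge> 2" "even (k l)" using ev step.hyps step.prems by auto
  have A: "A p \<in> K d k" if "p \<in> {1..k l}" for p
    unfolding A_def using that step.prems step.hyps k1
    by (intro fill_in_K) (auto simp: element_at_def)
  \<comment> \<open>The parity of the position at level l is the direction at the next level, so
    directions alternate from one sub-block to the next.\<close>
  have indA: "ind k (A p) (Suc l) = p mod 2" if "p \<in> {1..k l}" for p
  proof -
    obtain l' where l': "l = Suc l'" using step.prems(1) by (cases l) auto
    have "ind k (A p) (Suc l) = num (k l) (ind k (A p) l) (A p l) mod 2" unfolding l' by simp
    also have "ind k (A p) l = ?b" unfolding A_def by (rule ind_fill)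
    also have "num (k l) ?b (A p l) = p" using that by (auto simp: num_def A_def fill_def element_at_def)
    finally show ?thesis .
  qed
  \<comment> \<open>The two ends of the traversal of the p-th sub-block.\<close>
  define first where "first p = fill d (Suc l) (A p) (element_at (k (Suc l)) (p mod 2) 1)" for p
  define last where "last p = fill d (Suc l) (A p) (element_at (k (Suc l)) (p mod 2) (k (Suc l)))" for p
  have kSl: "k (Suc l) \<ge> 1" using k1 step.hyps by simp
  have sub: "2 ^ E * c (first p) \<le> c (last p)" if "p \<in> {1..k l}" for p
    using step.IH[OF _ A[OF that]] unfolding first_def last_def E_def indA[OF that] by simp
  have link: "c (last p) \<le> c (first (Suc p))" if "p \<in> {1..<k l}" for p
  proof -
    let ?\<beta> = "first (Suc p)"
    have \<beta>: "?\<beta> \<in> K d k"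
      unfolding first_def using that step.hyps k1 kSl
      by (intro fill_in_K A) (auto simp: element_at_def)
    \<comment> \<open>The turn of the Gray code: opposite directions make the end of one sub-block
      and the start of the next share coordinate \<open>Suc l\<close>, leaving only coordinate l
      different.\<close>
    have "element_at (k (Suc l)) (p mod 2) (k (Suc l)) = element_at (k (Suc l)) (Suc p mod 2) 1"
      by (cases "even p") (auto simp: element_at_def mod_Suc even_iff_mod_2_eq_zero)
    then have "last p = ?\<beta>(l := element_at (k l) ?b p)"
      unfolding first_def last_def by (auto simp: fill_def A_def)
    moreover have "?\<beta> l = element_at (k l) ?b (Suc p)" by (simp add: first_def fill_def A_def)
    moreover have "ind k ?\<beta> l = ?b"
      by (rule ind_cong) (auto simp: first_def fill_def A_def)
    moreover have "element_at (k l) ?b p \<in> {1..k l}"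
        "precedes ?b (element_at (k l) ?b p) (element_at (k l) ?b (Suc p))"
      using that by (auto simp: element_at_def precedes_def)
    ultimately show ?thesis
      \<comment> \<open>The singleton case of dominance compares the two sides of the turn.\<close>
      using dom[unfolded dominating_def, rule_format, OF \<beta>, of l "{element_at (k l) ?b p}"]
        step.prems step.hyps by simp
  qed
  have "2 ^ (E * p) * c (first 1) \<le> c (last p)" if "1 \<le> p" "p \<le> k l" for p
    using that
  proof (induction p rule: dec_induct)
    case base
    then show ?case using sub[of 1] by simp
  next
    case (step p)
    have "2 ^ (E * Suc p) * c (first 1) = 2 ^ E * (2 ^ (E * p) * c (first 1))"
      by (simp add: power_add mult.assoc)
    also have "\<dots> \<le> 2 ^ E * c (last p)" using step by (intro mult_left_mono) auto
    also have "\<dots> \<le> 2 ^ E * c (first (Suc p))" using link[of p] step by (intro mult_left_mono) auto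
    also have "\<dots> \<le> c (last (Suc p))" using sub[of "Suc p"] step by simp
    finally show ?case .
  qed
  from this[of "k l"] have "2 ^ (E * k l) * c (first 1) \<le> c (last (k l))" using kl by simp
  \<comment> \<open>Position 1 is odd, so the first sub-block is traversed upwards and starts at
    1.\<close>
  moreover have "first 1 = A 1"
    using fill_fill[OF \<open>l < d\<close>] by (simp add: first_def A_def element_at_def)
  \<comment> \<open>Here evenness of \<open>k l\<close> matters: the last sub-block is traversed
    downwards and ends at 1.\<close>
  moreover have "last (k l) = A (k l)"
    using fill_fill[OF \<open>l < d\<close>] kl(2) by (simp add: last_def A_def element_at_def)
  moreover have "(k d - 2) * (\<Prod>i=l..<d. k i) = E * k l"
    using step.hyps by (simp add: E_def prod.atLeast_Suc_lessThan mult_ac)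
  ultimately show ?case by (simp add: A_def)
qed


section \<open>A gate of degree \<open>d\<close>\<close>

text \<open>The position in the order, counted from 0; it is the exponent of 2 in the explicit
  gate.\<close>

definition K_rank :: "nat \<Rightarrow> (nat \<Rightarrow> nat) \<Rightarrow> (nat \<Rightarrow> nat) \<Rightarrow> nat" where
  "K_rank d k \<alpha> = card {\<beta> \<in> K d k. K_less d k \<beta> \<alpha>}"

lemma K_rank_less:
  assumes "\<alpha> \<in> K d k" "K_less d k \<alpha> \<beta>"
  shows "K_rank d k \<alpha> < K_rank d k \<beta>"
  unfolding K_rank_def
proof (rule psubset_card_mono)
  show "finite {\<gamma> \<in> K d k. K_less d k \<gamma> \<beta>}" using finite_K by simp
  have "\<alpha> \<in> {\<gamma> \<in> K d k. K_less d k \<gamma> \<beta>}" "\<alpha> \<notin> {\<gamma> \<in> K d k. K_less d k \<gamma> \<alpha>}"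
    using assms K_less_irrefl by auto
  moreover have "{\<gamma> \<in> K d k. K_less d k \<gamma> \<alpha>} \<subseteq> {\<gamma> \<in> K d k. K_less d k \<gamma> \<beta>}"
    using assms(2) K_less_trans by blast
  ultimately show "{\<gamma> \<in> K d k. K_less d k \<gamma> \<alpha>} \<subset> {\<gamma> \<in> K d k. K_less d k \<gamma> \<beta>}" by blast
qed

lemma inj_on_K_rank: "inj_on (K_rank d k) (K d k)"
proof (rule inj_onI, rule ccontr)
  fix \<alpha> \<beta> assume *: "\<alpha> \<in> K d k" "\<beta> \<in> K d k" "K_rank d k \<alpha> = K_rank d k \<beta>" "\<alpha> \<noteq> \<beta>"
  then show False using K_less_total[OF *(1,2,4)] by (auto dest: K_rank_less)
qed

lemma abs_diff_prod_le_1: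
  assumes "z \<in> cube (xy_vars d k)" "\<alpha> \<in> K d k"
  shows "\<bar>diff_prod d z \<alpha>\<bar> \<le> 1"
  unfolding diff_prod_def
proof (rule abs_prod_le_1)
  fix i assume i: "i \<in> {1..d}"
  then have "\<alpha> i \<in> {1..k i}" using assms(2) by (auto simp: K_def)
  then have "X i (\<alpha> i) \<in> xy_vars d k" "Y i (\<alpha> i) \<in> xy_vars d k"
    using i unfolding xy_vars_def by blast+
  then show "\<bar>z (X i (\<alpha> i)) - z (Y i (\<alpha> i))\<bar> \<le> 1"
    using cube_01[OF assms(1), of "X i (\<alpha> i)"] cube_01[OF assms(1), of "Y i (\<alpha> i)"] by auto
qed

lemma sum_power2_less: "(\<Sum>r<n. 2 ^ r :: int) < 2 ^ n"
  by (induction n) simp_all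

text \<open>The leading product is 1 or -1, and its weight exceeds the sum of all smaller powers of
  2, so it decides the sign.\<close>

lemma sgn01_rank_sum:
  assumes z: "z \<in> cube (xy_vars d k)"
  shows "xy_fun d k z = sgn01 (\<Sum>\<alpha>\<in>K d k. 2 ^ K_rank d k \<alpha> * diff_prod d z \<alpha>)"
proof (cases "nonvanishing d k z = {}")
  case True
  \<comment> \<open>With no leading index the sum is 0, and \<open>sgn01\<close> at 0 agrees with
    the default value 1 of f.\<close>
  then have "(\<Sum>\<alpha>\<in>K d k. 2 ^ K_rank d k \<alpha> * diff_prod d z \<alpha>) = 0"
    by (intro sum.neutral) (auto simp: nonvanishing_def)
  then show ?thesis using True by (simp add: xy_fun_def sgn01_def)
next
  case False
  let ?N = "nonvanishing d k z"
  have NK: "?N \<subseteq> K d k" by (auto simp: nonvanishing_def)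
  then obtain \<alpha> where \<alpha>: "is_largest d k ?N \<alpha>" using ex1_is_largest False by blast
  then have \<alpha>N: "\<alpha> \<in> ?N" by (simp add: is_largest_def)
  let ?s = "\<Sum>\<beta>\<in>?N - {\<alpha>}. 2 ^ K_rank d k \<beta> * diff_prod d z \<beta>"
  have finN: "finite ?N" using NK finite_K by (rule finite_subset)
  have "(\<Sum>\<beta>\<in>K d k. 2 ^ K_rank d k \<beta> * diff_prod d z \<beta>) =
      (\<Sum>\<beta>\<in>?N. 2 ^ K_rank d k \<beta> * diff_prod d z \<beta>)"
    using NK finite_K by (intro sum.mono_neutral_right) (auto simp: nonvanishing_def)
  also have "\<dots> = 2 ^ K_rank d k \<alpha> * diff_prod d z \<alpha> + ?s"
    using finN \<alpha>N by (rule sum.remove)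
  finally have eq: "(\<Sum>\<beta>\<in>K d k. 2 ^ K_rank d k \<beta> * diff_prod d z \<beta>) =
      2 ^ K_rank d k \<alpha> * diff_prod d z \<alpha> + ?s" .
  have "\<bar>?s\<bar> \<le> (\<Sum>\<beta>\<in>?N - {\<alpha>}. \<bar>2 ^ K_rank d k \<beta> * diff_prod d z \<beta>\<bar>)" by (rule sum_abs)
  also have "\<dots> \<le> (\<Sum>\<beta>\<in>?N - {\<alpha>}. 2 ^ K_rank d k \<beta>)"
    using abs_diff_prod_le_1[OF z] NK by (intro sum_mono) (auto simp: abs_mult mult_left_le)
  \<comment> \<open>Distinct indices have distinct ranks, so this is a sum of distinct powers of
    2.\<close>
  also have "\<dots> = (\<Sum>r\<in>K_rank d k ` (?N - {\<alpha>}). 2 ^ r)"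
    using inj_on_subset[OF inj_on_K_rank] NK by (subst sum.reindex) (auto intro: inj_on_subset)
  also have "\<dots> \<le> (\<Sum>r<K_rank d k \<alpha>. 2 ^ r)"
  proof (rule sum_mono2)
    show "K_rank d k ` (?N - {\<alpha>}) \<subseteq> {..<K_rank d k \<alpha>}"
    proof
      fix r assume "r \<in> K_rank d k ` (?N - {\<alpha>})"
      then obtain \<beta> where "r = K_rank d k \<beta>" "\<beta> \<in> K d k" "K_less d k \<beta> \<alpha>"
        using \<alpha> NK by (auto simp: is_largest_def)
      then show "r \<in> {..<K_rank d k \<alpha>}" using K_rank_less by simp
    qed
  qed simp_all
  also have "\<dots> < 2 ^ K_rank d k \<alpha>" by (rule sum_power2_less)
  finally have s: "\<bar>?s\<bar> < 2 ^ K_rank d k \<alpha>" .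
  have "diff_prod d z \<alpha> = 1 \<or> diff_prod d z \<alpha> = -1"
    using abs_diff_prod_le_1[OF z, of \<alpha>] \<alpha>N by (auto simp: nonvanishing_def)
  then show ?thesis
    unfolding xy_fun_eq[OF \<alpha>] eq sgn01_def using s by auto
qed

lemma diff_prod_eq_sum_terms:
  "diff_prod d z \<alpha> = (\<Sum>T\<in>Pow {1..d}. (-1) ^ card T *
     (\<Prod>v\<in>(\<lambda>i. swap_blocks T (X i (\<alpha> i))) ` {1..d}. z v))"
proof -
  have "(\<Prod>v\<in>(\<lambda>i. swap_blocks T (X i (\<alpha> i))) ` {1..d}. z v) =
      (\<Prod>i=1..d. if i \<in> T then z (Y i (\<alpha> i)) else z (X i (\<alpha> i)))" for T
  proof -
    have "inj_on (\<lambda>i. swap_blocks T (X i (\<alpha> i))) {1..d}"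
      by (auto simp: inj_on_def swap_blocks_def split: if_splits)
    then show ?thesis by (subst prod.reindex) (auto simp: swap_blocks_def intro!: prod.cong)
  qed
  then show ?thesis by (simp add: diff_prod_def sum_Pow_prod_diff)
qed

lemma ex_gate_of_degree_le:
  "\<exists>p. threshold_gate (xy_vars d k) (xy_fun d k) p \<and> mpoly_degree p \<le> d"
proof -
  let ?M = "\<lambda>(\<alpha>, T). (\<lambda>i. swap_blocks T (X i (\<alpha> i))) ` {1..d}"
  let ?c = "\<lambda>(\<alpha>, T). 2 ^ K_rank d k \<alpha> * (-1) ^ card T :: int"
  have "\<exists>p. mpoly_vars p \<subseteq> xy_vars d k \<and> mpoly_degree p \<le> d \<and>
      (\<forall>z. mpoly_eval p z = (\<Sum>u\<in>K d k \<times> Pow {1..d}. ?c u * (\<Prod>v\<in>?M u. z v)))"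
  proof (rule ex_mpoly_of_terms)
    show "finite (K d k \<times> Pow {1..d})" using finite_K by simp
    fix u assume "u \<in> K d k \<times> Pow {1..d}"
    then obtain \<alpha> T where u: "u = (\<alpha>, T)" and \<alpha>: "\<alpha> \<in> K d k" by auto
    have "swap_blocks T (X i (\<alpha> i)) \<in> xy_vars d k" if i: "i \<in> {1..d}" for i
    proof -
      have "\<alpha> i \<in> {1..k i}" using \<alpha> i by (auto simp: K_def)
      then have "X i (\<alpha> i) \<in> xy_vars d k" using i unfolding xy_vars_def by blast
      then show ?thesis by (simp add: swap_blocks_in_xy_vars_iff)
    qed
    then show "finite (?M u) \<and> ?M u \<subseteq> xy_vars d k \<and> card (?M u) \<le> d"
      using card_image_le[of "{1..d}" "\<lambda>i. swap_blocks T (X i (\<alpha> i))"] by (auto simp: u)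
  qed
  then obtain p where p: "mpoly_vars p \<subseteq> xy_vars d k" "mpoly_degree p \<le> d"
      "\<And>z. mpoly_eval p z = (\<Sum>u\<in>K d k \<times> Pow {1..d}. ?c u * (\<Prod>v\<in>?M u. z v))"
    by auto
  have "mpoly_eval p z = (\<Sum>\<alpha>\<in>K d k. 2 ^ K_rank d k \<alpha> * diff_prod d z \<alpha>)" for z
    unfolding p(3) diff_prod_eq_sum_terms sum_distrib_left sum.cartesian_product
    by (intro sum.cong refl) (auto simp: mult.assoc)
  then have "threshold_gate (xy_vars d k) (xy_fun d k) p"
    unfolding threshold_gate_def using p(1) sgn01_rank_sum by simp
  then show ?thesis using p(2) by blast
qed


section \<open>The degree and weight of gates\<close>

text \<open>A gate of smaller degree antisymmetrizes to 0, yet the result must be positive at a test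
  point.\<close>

lemma gate_degree_ge:
  assumes "d \<ge> 1" "\<forall>i\<in>{1..d}. k i \<ge> 1" "threshold_gate (xy_vars d k) (xy_fun d k) p"
  shows "d \<le> mpoly_degree p"
proof (rule ccontr)
  assume low: "\<not> d \<le> mpoly_degree p"
  have vars: "mpoly_vars p \<subseteq> xy_vars d k" using assms(3) by (simp add: threshold_gate_def)
  have one: "restrict (\<lambda>_. 1) {1..d} \<in> K d k" using assms(2) by (auto simp: K_def)
  let ?z = "test_point d k (restrict (\<lambda>_. 1) {1..d}) 1 {}"
  have "antisymmetrize d (mpoly_eval p) ?z > 0"
    using is_largest_test_point[OF one, of 1 "{}"] diff_prod_test_point[OF one one, of 1 "{}"] assms(1)
    by (intro antisymmetrize_gate_pos[OF assms(1,3) test_point_in_cube]) auto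
  then show False
    using antisymmetrize_gate_low_degree[OF vars _ test_point_in_cube] low by simp
qed

lemma gate_weight_ge:
  assumes "d \<ge> 1" and ev: "\<forall>i\<in>{1..<d}. k i \<ge> 2 \<and> even (k i)" and kd: "k d \<ge> 3"
    and gate: "threshold_gate (xy_vars d k) (xy_fun d k) p" and deg: "mpoly_degree p \<le> d"
  shows "2 ^ ((k d - 2) * (\<Prod>i=1..<d. k i)) \<le> 2 ^ d * mpoly_weight p"
proof -
  have vars: "mpoly_vars p \<subseteq> xy_vars d k" using gate by (simp add: threshold_gate_def)
  obtain c where c: "\<forall>z\<in>cube (xy_vars d k).
      antisymmetrize d (mpoly_eval p) z = (\<Sum>\<alpha>\<in>K d k. c \<alpha> * diff_prod d z \<alpha>)"
    using antisymmetrize_gate_multilinear[OF vars deg] by blast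
  have dom: "dominating d k c" by (rule dominating_gate_coefficients[OF assms(1) gate c])
  have k1: "\<forall>i\<in>{1..d}. k i \<ge> 1" using ev kd by (rule k_pos)
  have one: "restrict (\<lambda>_. 1) {1..d} \<in> K d k" using k1 by (auto simp: K_def)
  let ?F = "\<lambda>a. fill d 1 (restrict (\<lambda>_. 1) {1..d}) a"
  have FK: "?F a \<in> K d k" if "a \<in> {1..k 1}" for a
    using one assms(1) that k1 by (intro fill_in_K) auto
  have k1_1: "k 1 \<ge> 1" using k1 assms(1) by simp
  let ?E = "(k d - 2) * (\<Prod>i=1..<d. k i)"
  \<comment> \<open>The starting coefficient is a positive integer, hence at least 1.\<close>
  have "2 ^ ?E * 1 \<le> 2 ^ ?E * c (?F 1)"
    using dominating_pos[OF dom assms(1) FK[of 1]] k1_1 by (intro mult_left_mono) auto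
  \<comment> \<open>At level 1 the direction is 1, so the traversal of all of \<open>K\<close> runs
    from first coordinate 1 to \<open>k 1\<close>.\<close>
  also have "\<dots> \<le> c (?F (k 1))"
    using block_growth[OF dom order_refl assms(1) ev kd one] by (simp add: element_at_def)
  also have "\<dots> \<le> 2 ^ d * int (mpoly_weight p)"
    using k1_1 by (intro gate_coefficient_le[OF assms(1) vars FK c]) auto
  finally have "int (2 ^ ?E) \<le> int (2 ^ d * mpoly_weight p)" by simp
  then show ?thesis by (simp only: of_nat_le_iff)
qed

theorem theorem3p2:
  fixes d :: nat and k :: "nat \<Rightarrow> nat"
  assumes "d \<ge> 1"
    and "\<forall>i\<in>{1..<d}. k i \<ge> 2 \<and> even (k i)"
    and "k d \<ge> 3"
  shows "threshold_degree (xy_vars d k) (xy_fun d k) = d \<and>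
    real (threshold_weight (xy_vars d k) (xy_fun d k) d)
      \<ge> 2 powr ((real (k d) - 2) * (\<Prod>i\<in>{1..<d}. real (k i)) - real d)"
proof
  let ?V = "xy_vars d k" and ?f = "xy_fun d k"
  have k1: "\<forall>i\<in>{1..d}. k i \<ge> 1" using assms(2,3) by (rule k_pos)
  obtain p where p: "threshold_gate ?V ?f p" "mpoly_degree p \<le> d"
    using ex_gate_of_degree_le by blast
  have "mpoly_degree p = d" using gate_degree_ge[OF assms(1) k1 p(1)] p(2) by simp
  then show "threshold_degree ?V ?f = d"
    unfolding threshold_degree_def using p(1) gate_degree_ge[OF assms(1) k1]
    by (intro Least_equality) auto
  \<comment> \<open>Existence of a gate ensures that the \<open>LEAST\<close> in
    \<open>threshold_weight\<close> is attained.\<close>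
  have "\<exists>w q. threshold_gate ?V ?f q \<and> mpoly_degree q \<le> d \<and> mpoly_weight q = w" using p by blast
  then have "\<exists>q. threshold_gate ?V ?f q \<and> mpoly_degree q \<le> d \<and> mpoly_weight q = threshold_weight ?V ?f d"
    unfolding threshold_weight_def by (rule LeastI_ex)
  then obtain q where q: "threshold_gate ?V ?f q" "mpoly_degree q \<le> d"
      "mpoly_weight q = threshold_weight ?V ?f d"
    by blast
  let ?E = "(k d - 2) * (\<Prod>i=1..<d. k i)"
  \<comment> \<open>Natural and real subtraction agree because \<open>k d\<close> is at least
    3.\<close>
  have E: "(real (k d) - 2) * (\<Prod>i\<in>{1..<d}. real (k i)) = real ?E"
    using assms(3) by simp
  have "2 ^ ?E \<le> 2 ^ d * threshold_weight ?V ?f d"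
    using gate_weight_ge[OF assms q(1,2)] q(3) by simp
  then have "real (2 ^ ?E) \<le> real (2 ^ d * threshold_weight ?V ?f d)" by (simp only: of_nat_le_iff)
  then have "(2::real) ^ ?E / 2 ^ d \<le> real (threshold_weight ?V ?f d)"
    by (simp add: field_simps)
  then show "real (threshold_weight ?V ?f d)
      \<ge> 2 powr ((real (k d) - 2) * (\<Prod>i\<in>{1..<d}. real (k i)) - real d)"
    unfolding E powr_diff by (simp only: powr_realpow zero_less_numeral)
qed

end
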